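(* Let $(\Omega,\rho)$ be a compact metric space equipped with a Borel probability measure $P$, containing the set $\mathbb{N}$ of non-negative integers as a dense subset. Let $\{x(n)\}$ be a sequence of elements of the unit interval, i.e. a mapping $x:\mathbb{N}\to[0,1]$. Then $\{x(n)\}$ is $\pi$-uniformly measurable if and only if for each sequence $\{k_n\}$ of elements of $\mathbb{N}$ that is uniformly distributed in $\Omega$ we have $$\lim_{N\to\infty}\frac1N\sum_{n=1}^N f(x(k_n))=\int_0^1 f(t)\,dt$$ for every Riemann integrable real function $f$ defined on $[0,1]$. The same equivalence holds with "every Riemann integrable real function $f$" replaced by "every continuous real function $f$".
   Context: For $S\subset\mathbb{N}$ put $\pi^\ast(S)=P(cl(S))$, where $cl$ is the closure in $\Omega$. Let $\mathcal{Y}$ be the system of all $A\subset\mathbb{N}$ with $\pi^\ast(A)+\pi^\ast(\mathbb{N}\setminus A)=1$, and let $\pi=\pi^\ast|_{\mathcal{Y}}$. A mapping $x:\mathbb{N}\to[0,1]$ is $\pi$-uniformly measurable if for each subinterval $I\subset[0,1]$ the set $x^{-1}(I)$ belongs to $\mathcal{Y}$ and $\pi(x^{-1}(I))=|I|$, the length of $I$. A sequence $\{a_n\}$ of elements of $\Omega$ is uniformly distributed in $\Omega$ if $\lim_{N\to\infty}\frac1N\sum_{n=1}^N g(a_n)=\int g\,dP$ for every continuous real function $g$ on $\Omega$. *)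

theory Defs
  imports "HOL-Analysis.Analysis" "HOL-Probability.Probability"
begin

text \<open>
  Throughout, the compact space is the type \<open>'a\<close>, and \<open>\<iota> :: nat \<Rightarrow> 'a\<close> is the injection with dense
  range through which the non-negative integers are regarded as a subset of it. No relation between
  the induced topology and any topology of \<open>nat\<close> is assumed.
\<close>

definition upper_dens :: "(nat \<Rightarrow> 'a::topological_space) \<Rightarrow> 'a measure \<Rightarrow> nat set \<Rightarrow> real" where
  "upper_dens \<iota> P S = measure P (closure (\<iota> ` S))"

definition dens_sets :: "(nat \<Rightarrow> 'a::topological_space) \<Rightarrow> 'a measure \<Rightarrow> nat set set" where
  "dens_sets \<iota> P = {A. upper_dens \<iota> P A + upper_dens \<iota> P (UNIV - A) = 1}"

definition dens :: "(nat \<Rightarrow> 'a::topological_space) \<Rightarrow> 'a measure \<Rightarrow> nat set \<Rightarrow> real" where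
  "dens \<iota> P = restrict (upper_dens \<iota> P) (dens_sets \<iota> P)"

text \<open>Subintervals may be open, closed, half-open or degenerate.\<close>

definition dens_uniformly_measurable ::
    "(nat \<Rightarrow> 'a::topological_space) \<Rightarrow> 'a measure \<Rightarrow> (nat \<Rightarrow> real) \<Rightarrow> bool" where
  "dens_uniformly_measurable \<iota> P x \<longleftrightarrow>
     (\<forall>I. is_interval I \<and> I \<subseteq> {0..1} \<longrightarrow>
        x -` I \<in> dens_sets \<iota> P \<and> dens \<iota> P (x -` I) = measure lborel I)"

text \<open>Sequences are indexed from 1; the value at 0 is irrelevant.\<close>

definition uniformly_distributed :: "'a::topological_space measure \<Rightarrow> (nat \<Rightarrow> 'a) \<Rightarrow> bool" where
  "uniformly_distributed P a \<longleftrightarrow>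
     (\<forall>g :: 'a \<Rightarrow> real. continuous_on UNIV g \<longrightarrow>
        (\<lambda>N. (1 / real N) * (\<Sum>n=1..N. g (a n))) \<longlonglongrightarrow> integral\<^sup>L P g)"

text \<open>
  Riemann integrability: the Riemann sums over tagged partitions converge as the mesh tends to 0.
  In contrast to the library's gauge integral, the mesh bound \<open>\<delta>\<close> is a constant. A function that is
  Riemann integrable in this sense is also gauge integrable, with the same integral.
\<close>

definition riemann_integrable :: "(real \<Rightarrow> real) \<Rightarrow> real \<Rightarrow> real \<Rightarrow> bool" where
  "riemann_integrable f a b \<longleftrightarrow>
     (\<exists>J. \<forall>\<epsilon>>0. \<exists>\<delta>>0. \<forall>p. p tagged_division_of {a..b} \<and> (\<forall>(t, K)\<in>p. measure lborel K < \<delta>) \<longrightarrow>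
        \<bar>(\<Sum>(t, K)\<in>p. measure lborel K * f t) - J\<bar> < \<epsilon>)"

end

theory Submission
  imports Defs
begin

text \<open>
  If \<open>A = x -` I\<close> is measurable, the portmanteau inequality for the closures of \<open>A\<close> and of its
  complement squeezes the frequency of \<open>A\<close> along \<open>k\<close> to \<open>|I|\<close>, and a regular partition of \<open>[0,1]\<close>
  passes from intervals to Riemann integrable functions.
  Conversely, given \<open>A\<close>, take a uniformly distributed sequence in the compact space that visits the
  closed set \<open>cl A\<close> with frequency exactly \<open>P (cl A)\<close> (an independent sample does so almost surely),
  and replace its terms by ever closer natural numbers, chosen in \<open>A\<close> whenever the term lies in
  \<open>cl A\<close>. The hypothesis on \<open>x\<close> along this sequence gives \<open>P (cl A) \<le> |I|\<close>; likewise for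
  the complement, and the two closures cover the space.
\<close>

section \<open>Averages of real sequences indexed from 1\<close>

text \<open>The body repeats verbatim the averages in \<open>uniformly_distributed\<close> and in
  the theorem, so that unfolding it translates between the two. At \<open>N = 0\<close> the value is
  0, because division by zero yields 0.\<close>

definition mean :: "(nat \<Rightarrow> real) \<Rightarrow> nat \<Rightarrow> real" where
  "mean h N = (1 / real N) * (\<Sum>n=1..N. h n)"

lemma mean_mono: "(\<And>n. n \<ge> 1 \<Longrightarrow> h n \<le> h' n) \<Longrightarrow> mean h N \<le> mean h' N"
  unfolding mean_def by (intro mult_left_mono sum_mono) auto

lemma mean_add: "mean (\<lambda>n. h n + h' n) N = mean h N + mean h' N"
  by (simp add: mean_def sum.distrib algebra_simps)

lemma mean_diff: "mean (\<lambda>n. h n - h' n) N = mean h N - mean h' N"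
  by (simp add: mean_def sum_subtractf algebra_simps)

lemma mean_minus: "mean (\<lambda>n. - h n) N = - mean h N"
  by (simp add: mean_def sum_negf)

lemma mean_const: "N \<ge> 1 \<Longrightarrow> mean (\<lambda>n. c) N = c"
  by (simp add: mean_def)

lemma mean_sum_scaled:
  "mean (\<lambda>n. \<Sum>i\<in>I. c i * h i n) N = (\<Sum>i\<in>I. c i * mean (h i) N)"
  unfolding mean_def sum_distrib_left by (subst sum.swap) (simp add: mult_ac)

lemma abs_mean_le:
  assumes "\<And>n. n \<ge> 1 \<Longrightarrow> \<bar>h n\<bar> \<le> c" "c \<ge> 0"
  shows "\<bar>mean h N\<bar> \<le> c"
proof (cases "N = 0")
  case False
  have "mean h N \<le> mean (\<lambda>_. c) N" "mean (\<lambda>_. - c) N \<le> mean h N"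
    using assms by (force intro!: mean_mono simp: abs_le_iff minus_le_iff)+
  with False show ?thesis by (simp add: mean_const)
qed (simp add: mean_def assms)

text \<open>Cesaro: up to the index \<open>M\<close> beyond which the terms are below
  \<open>e / 2\<close>, the sequence contributes at most a constant divided by \<open>N\<close>; the
  later terms contribute at most \<open>e / 2\<close>.\<close>

lemma tendsto_zero_mean:
  assumes "h \<longlonglongrightarrow> 0"
  shows "mean h \<longlonglongrightarrow> 0"
proof (rule LIMSEQ_I)
  fix e :: real assume e: "e > 0"
  obtain M where M: "\<And>n. n \<ge> M \<Longrightarrow> \<bar>h n\<bar> < e / 2"
    using LIMSEQ_D[OF assms, of "e / 2"] e by auto
  define C where "C = (\<Sum>n=1..M. \<bar>h n\<bar>)"
  have bound: "\<bar>mean h N\<bar> \<le> C / real N + e / 2" if N: "N \<ge> 1" for N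
  proof -
    have "\<bar>\<Sum>n=1..N. h n\<bar> \<le> (\<Sum>n=1..N. \<bar>h n\<bar>)" by (rule sum_abs)
    \<comment> \<open>Adding \<open>e / 2\<close> to every summand, including those up to
      \<open>M\<close>, lets the early terms and the tail bound separate into two sums.\<close>
    also have "\<dots> \<le> (\<Sum>n=1..N. (if n \<in> {..M} then \<bar>h n\<bar> else 0) + e / 2)"
      using M e by (intro sum_mono) (auto simp: not_le intro: less_imp_le)
    also have "\<dots> = (\<Sum>n\<in>{1..N} \<inter> {..M}. \<bar>h n\<bar>) + real N * (e / 2)"
      unfolding sum.distrib sum.inter_restrict[OF finite_atLeastAtMost, symmetric] by simp
    also have "(\<Sum>n\<in>{1..N} \<inter> {..M}. \<bar>h n\<bar>) \<le> C"
      unfolding C_def by (intro sum_mono2) auto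
    finally have "\<bar>\<Sum>n=1..N. h n\<bar> / real N \<le> (C + real N * (e / 2)) / real N"
      by (rule divide_right_mono) simp_all
    also have "\<dots> = C / real N + e / 2" using N by (simp add: add_divide_distrib)
    finally show ?thesis by (simp add: mean_def abs_mult)
  qed
  have "(\<lambda>N. C / real N) \<longlonglongrightarrow> 0"
    by (rule lim_const_over_n)
  then obtain K where "\<And>N. N \<ge> K \<Longrightarrow> \<bar>C / real N\<bar> < e / 2"
    using LIMSEQ_D[of "\<lambda>N. C / real N" 0 "e / 2"] e by auto
  then have "\<bar>mean h N\<bar> < e" if "N \<ge> max K 1" for N
  proof -
    from that have "N \<ge> K" "N \<ge> 1" by simp_all
    then have "\<bar>C / real N\<bar> < e / 2" "\<bar>mean h N\<bar> \<le> C / real N + e / 2"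
      using bound \<open>\<And>N. N \<ge> K \<Longrightarrow> \<bar>C / real N\<bar> < e / 2\<close> by blast+
    then show ?thesis by linarith
  qed
  then show "\<exists>K. \<forall>N\<ge>K. norm (mean h N - 0) < e"
    unfolding real_norm_def diff_0_right by blast
qed

text \<open>Asymptotically equal sequences have the same limiting mean. This is what allows the
  terms of a uniformly distributed sequence to be replaced by nearby natural numbers.\<close>

lemma mean_cong_lim:
  assumes "(\<lambda>n. h n - h' n) \<longlonglongrightarrow> 0" "mean h' \<longlonglongrightarrow> l"
  shows "mean h \<longlonglongrightarrow> l"
  using tendsto_add[OF tendsto_zero_mean[OF assms(1)] assms(2)] by (simp add: mean_diff)

subsection \<open>Frequencies of independent samples\<close>

text \<open>The strong law of large numbers for the indicators of \<open>S\<close>. Hoeffding's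
  inequality bounds the probability of a deviation by at least \<open>e\<close> geometrically in
  \<open>N\<close>; the bounds are summable, so by Borel-Cantelli almost every sample deviates that
  far only finitely often.\<close>

lemma AE_frequency_tendsto:
  fixes P :: "'a measure"
  assumes "prob_space P" and S: "S \<in> sets P"
  shows "AE \<omega> in PiM (UNIV :: nat set) (\<lambda>_. P). mean (\<lambda>n. indicator S (\<omega> n)) \<longlonglongrightarrow> measure P S"
proof -
  let ?M = "PiM (UNIV :: nat set) (\<lambda>_. P)"
  interpret M: prob_space ?M using assms(1) by (intro prob_space_PiM)
  have distr_coord: "distr ?M P (\<lambda>\<omega>. \<omega> n) = P" for n
    using assms(1) by (intro distr_PiM_component) auto
  have [measurable]: "S \<in> sets P" by fact
  define X :: "nat \<Rightarrow> (nat \<Rightarrow> 'a) \<Rightarrow> real" where "X = (\<lambda>n \<omega>. indicator S (\<omega> n))"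
  \<comment> \<open>The joint law of all coordinates is the law of the identity map, so independence
    amounts to every coordinate having law \<open>P\<close>.\<close>
  have indep0: "M.indep_vars (\<lambda>_. P) (\<lambda>i \<omega>. \<omega> i) (UNIV :: nat set)"
    by (subst M.indep_vars_iff_distr_eq_PiM') (simp_all add: distr_coord restrict_UNIV distr_id)
  have X_meas [measurable]: "X n \<in> borel_measurable ?M" for n
    unfolding X_def by measurable
  have indep: "M.indep_vars (\<lambda>_. borel) X UNIV"
    unfolding X_def by (rule M.indep_vars_compose2[OF indep0]) simp
  have exp_X: "M.expectation (X n) = measure P S" for n
  proof -
    have "M.expectation (X n) = integral\<^sup>L (distr ?M P (\<lambda>\<omega>. \<omega> n)) (indicator S)"
      unfolding X_def by (subst integral_distr) auto
    then show ?thesis by (simp add: distr_coord)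
  qed
  have AE_eps: "AE \<omega> in ?M. \<forall>\<^sub>F N in sequentially. \<bar>mean (\<lambda>n. X n \<omega>) N - measure P S\<bar> < e"
    if e: "e > 0" for e
  proof -
    \<comment> \<open>The deviation is that of the sum, as in Hoeffding's inequality. For
      \<open>N = 0\<close> the event is the whole space, and the factor 2 in the bound below covers
      it.\<close>
    define B where "B N = {\<omega>\<in>space ?M. \<bar>(\<Sum>n=1..N. X n \<omega>) - real N * measure P S\<bar> \<ge> real N * e}" for N
    have B_sets [measurable]: "B N \<in> sets ?M" for N unfolding B_def by measurable
    have B_le: "M.prob (B N) \<le> 2 * exp (- 2 * e\<^sup>2) ^ N" for N
    proof (cases "N = 0")
      case False
      interpret H: Hoeffding_ineq ?M "{1..N}" X "\<lambda>_. 0" "\<lambda>_. 1" "\<Sum>n=1..N. M.expectation (X n)"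
      proof unfold_locales
        show "M.indep_vars (\<lambda>_. borel) X {1..N}" by (rule M.indep_vars_subset[OF indep]) simp
      qed (simp_all add: X_def indicator_def)
      have "M.prob (B N) \<le> 2 * exp (-2 * (real N * e)\<^sup>2 / (\<Sum>i=1..N. (1 - 0)\<^sup>2))"
        using H.Hoeffding_ineq_abs_ge[of "real N * e"] False e by (simp add: exp_X B_def)
      \<comment> \<open>The \<open>N\<close> variables range over an interval of length 1, so the
        squared ranges sum to \<open>N\<close> and the exponent is linear in \<open>N\<close>, which
        makes the bound a geometric term.\<close>
      also have "-2 * (real N * e)\<^sup>2 / (\<Sum>i=1..N. (1 - 0)\<^sup>2) = real N * (- 2 * e\<^sup>2)"
        using False by (simp add: power2_eq_square)
      finally show ?thesis unfolding exp_of_nat_mult .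
    next
      case True
      have "M.prob (B N) \<le> 2" by (rule order_trans[OF M.prob_le_1]) simp
      then show ?thesis using True by simp
    qed
    have "summable (\<lambda>N. M.prob (B N))"
    proof (rule summable_comparison_test)
      show "summable (\<lambda>N. 2 * exp (- 2 * e\<^sup>2) ^ N)"
        using e by (intro summable_mult summable_geometric) simp
      show "\<exists>N0. \<forall>N\<ge>N0. norm (M.prob (B N)) \<le> 2 * exp (- 2 * e\<^sup>2) ^ N"
        using B_le by auto
    qed
    then have "AE \<omega> in ?M. \<forall>\<^sub>F N in sequentially. \<omega> \<in> space ?M - B N"
      by (intro borel_cantelli_AE1) (simp_all add: M.emeasure_eq_measure)
    then show ?thesis
    proof (rule AE_mp, intro AE_I2 impI)
      fix \<omega> assume "\<forall>\<^sub>F N in sequentially. \<omega> \<in> space ?M - B N"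
      then show "\<forall>\<^sub>F N in sequentially. \<bar>mean (\<lambda>n. X n \<omega>) N - measure P S\<bar> < e"
        using eventually_ge_at_top[of 1]
      proof eventually_elim
        case (elim N)
        then have "\<bar>(\<Sum>n=1..N. X n \<omega>) - real N * measure P S\<bar> < real N * e" by (auto simp: B_def)
        moreover have "(\<Sum>n=1..N. X n \<omega>) - real N * measure P S = real N * (mean (\<lambda>n. X n \<omega>) N - measure P S)"
          using elim by (simp add: mean_def right_diff_distrib)
        ultimately show ?case using elim by (simp add: abs_mult)
      qed
    qed
  qed
  \<comment> \<open>Countably many tolerances are enough for convergence, and only countably many
    exceptional null sets may be united.\<close>
  have "AE \<omega> in ?M. \<forall>m. \<forall>\<^sub>F N in sequentially. \<bar>mean (\<lambda>n. X n \<omega>) N - measure P S\<bar> < 1 / real (Suc m)"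
    by (subst AE_all_countable) (auto intro!: AE_eps)
  then show ?thesis
  proof (rule AE_mp, intro AE_I2 impI tendstoI)
    fix \<omega> and e :: real
    assume *: "\<forall>m. \<forall>\<^sub>F N in sequentially. \<bar>mean (\<lambda>n. X n \<omega>) N - measure P S\<bar> < 1 / real (Suc m)"
      and "e > 0"
    obtain m where "1 / real (Suc m) < e" using \<open>e > 0\<close> by (rule nat_approx_posE)
    then show "\<forall>\<^sub>F N in sequentially. dist (mean (\<lambda>n. indicator S (\<omega> n)) N) (measure P S) < e"
      using *[rule_format, of m] by (auto elim!: eventually_mono simp: dist_real_def X_def)
  qed
qed

text \<open>The exceptional null sets of countably many sets unite to a null set, so almost every
  sample has all the frequencies at once; in a probability space such a sample exists.\<close>

lemma exists_sequence_frequencies: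
  assumes "prob_space P" "countable \<S>" "\<S> \<subseteq> sets P"
  obtains a :: "nat \<Rightarrow> 'a" where
    "\<And>S. S \<in> \<S> \<Longrightarrow> mean (\<lambda>n. indicator S (a n)) \<longlonglongrightarrow> measure P S"
proof -
  interpret M: prob_space "PiM (UNIV :: nat set) (\<lambda>_. P)" using assms(1) by (intro prob_space_PiM)
  have "AE \<omega> in PiM (UNIV :: nat set) (\<lambda>_. P). \<forall>S\<in>\<S>. mean (\<lambda>n. indicator S (\<omega> n)) \<longlonglongrightarrow> measure P S"
    using assms by (intro AE_ball_countable[THEN iffD2] ballI AE_frequency_tendsto) auto
  then have "\<exists>\<omega>. \<forall>S\<in>\<S>. mean (\<lambda>n. indicator S (\<omega> n)) \<longlonglongrightarrow> measure P S"
    using M.AE_False by (intro eventually_happens'[of "ae_filter (PiM (UNIV :: nat set) (\<lambda>_. P))"])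
      (auto simp: trivial_limit_def)
  then show thesis using that by blast
qed

subsection \<open>Portmanteau inequalities\<close>

lemma uniformly_distributed_iff_mean:
  "uniformly_distributed P a \<longleftrightarrow>
     (\<forall>g. continuous_on UNIV g \<longrightarrow> mean (\<lambda>n. g (a n)) \<longlonglongrightarrow> integral\<^sup>L P g)"
  unfolding uniformly_distributed_def mean_def[abs_def] ..

text \<open>The continuous functions \<open>max 0 (1 - m * infdist y C)\<close> majorize the
  indicator of \<open>C\<close> and converge to it pointwise because \<open>C\<close> is closed;
  dominated convergence with bound 1 carries this over to the integrals.\<close>

lemma indicator_closure_approx:
  fixes P :: "'a::metric_space measure"
  assumes "prob_space P" "sets P = sets borel" and C: "closed C" and e: "e > 0"
  obtains g :: "'a \<Rightarrow> real" where "continuous_on UNIV g" "\<And>y. indicator C y \<le> g y"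
    "integral\<^sup>L P g < measure P C + e"
proof (cases "C = {}")
  \<comment> \<open>\<open>infdist\<close> to the empty set is 0, so the functions used for nonempty
    \<open>C\<close> would be constantly 1 here; the zero function is taken instead.\<close>
  case True
  then show thesis using that[of "\<lambda>_. 0"] e by simp
next
  case False
  interpret P: prob_space P by fact
  define g :: "nat \<Rightarrow> 'a \<Rightarrow> real" where "g m y = max 0 (1 - real m * infdist y C)" for m y
  have cont: "continuous_on UNIV (g m)" for m
    unfolding g_def by (intro continuous_intros)
  have meas: "g m \<in> borel_measurable P" for m
    using borel_measurable_continuous_onI[OF cont] assms(2) measurable_cong_sets by blast
  have C_sets: "C \<in> sets P" using C assms(2) by simp
  have lim: "(\<lambda>m. integral\<^sup>L P (g m)) \<longlonglongrightarrow> integral\<^sup>L P (indicator C)"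
  proof (rule integral_dominated_convergence[where w = "\<lambda>_. 1"])
    show "AE y in P. (\<lambda>m. g m y) \<longlonglongrightarrow> indicator C y"
    proof (rule AE_I2)
      fix y
      show "(\<lambda>m. g m y) \<longlonglongrightarrow> indicator C y"
      proof (cases "y \<in> C")
        case True
        then show ?thesis by (simp add: g_def)
      next
        case y: False
        then have pos: "infdist y C > 0"
          using C False by (metis in_closed_iff_infdist_zero infdist_nonneg order_le_less)
        obtain M :: nat where M: "1 / infdist y C < real M" using reals_Archimedean2 by blast
        have "g m y = 0" if "m \<ge> M" for m
        proof -
          have "1 < real M * infdist y C" using M pos by (simp add: pos_divide_less_eq)
          also have "\<dots> \<le> real m * infdist y C" using that pos by (intro mult_right_mono) auto
          finally show ?thesis by (simp add: g_def)
        qed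
        then show ?thesis
          using y by (intro tendsto_eventually eventually_sequentiallyI[of M]) simp
      qed
    qed
  qed (use meas C_sets in \<open>auto simp: g_def infdist_nonneg\<close>)
  moreover have "integral\<^sup>L P (indicator C) = measure P C"
    using C_sets by simp
  ultimately have "\<forall>\<^sub>F m in sequentially. integral\<^sup>L P (g m) < measure P C + e"
    using e by (intro order_tendstoD) auto
  then obtain m where "integral\<^sup>L P (g m) < measure P C + e"
    using eventually_happens'[OF sequentially_bot] by blast
  moreover have "indicator C y \<le> g m y" for y
    by (cases "y \<in> C") (auto simp: g_def)
  ultimately show thesis using that cont by blast
qed

text \<open>The limsup half of the portmanteau theorem, phrased as an eventual bound: frequencies in
  \<open>C\<close> lie below the averages of a continuous majorant, which converge.\<close>

lemma uniformly_distributed_closed_upper: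
  fixes P :: "'a::metric_space measure"
  assumes "prob_space P" "sets P = sets borel" "uniformly_distributed P a" "closed C" "e > 0"
  shows "\<forall>\<^sub>F N in sequentially. mean (\<lambda>n. indicator C (a n)) N < measure P C + e"
proof -
  obtain g :: "'a \<Rightarrow> real" where g: "continuous_on UNIV g" "\<And>y. indicator C y \<le> g y"
    "integral\<^sup>L P g < measure P C + e"
    using indicator_closure_approx[OF assms(1,2,4,5)] by blast
  have "mean (\<lambda>n. g (a n)) \<longlonglongrightarrow> integral\<^sup>L P g"
    using assms(3) g(1) by (simp add: uniformly_distributed_iff_mean)
  then have "\<forall>\<^sub>F N in sequentially. mean (\<lambda>n. g (a n)) N < measure P C + e"
    using g(3) by (rule order_tendstoD)
  then show ?thesis
    by (rule eventually_mono) (rule le_less_trans[OF mean_mono], rule g(2))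
qed

text \<open>The frequencies of \<open>S\<close> and \<open>- S\<close> add up to 1, so an upper
  bound for the complement is a lower bound for \<open>S\<close>.\<close>

lemma mean_indicator_tendstoI:
  assumes "\<And>e. e > 0 \<Longrightarrow> \<forall>\<^sub>F N in sequentially. mean (\<lambda>n. indicator S (a n)) N < p + e"
    and "\<And>e. e > 0 \<Longrightarrow> \<forall>\<^sub>F N in sequentially. mean (\<lambda>n. indicator (- S) (a n)) N < 1 - p + e"
  shows "mean (\<lambda>n. indicator S (a n)) \<longlonglongrightarrow> p"
proof (rule tendstoI)
  fix e :: real assume "e > 0"
  from assms[OF this] eventually_ge_at_top[of 1]
  show "\<forall>\<^sub>F N in sequentially. dist (mean (\<lambda>n. indicator S (a n)) N) p < e"
  proof eventually_elim
    case (elim N)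
    have "mean (\<lambda>n. indicator S (a n)) N + mean (\<lambda>n. indicator (- S) (a n)) N = mean (\<lambda>_. 1) N"
      unfolding mean_add[symmetric] by (simp add: indicator_compl)
    with elim show ?case by (simp add: mean_const dist_real_def)
  qed
qed

text \<open>Visits of \<open>k\<close> to \<open>S\<close> are visits of \<open>\<phi> (k n)\<close>
  to the closure of the image of \<open>S\<close>, and likewise for the complement. The map
  \<open>\<phi>\<close> is kept general for two uses: the embedding of the naturals, and the
  identity of a metric space.\<close>

lemma mean_indicator_tendsto_closures:
  fixes P :: "'a::metric_space measure"
  assumes "prob_space P" "sets P = sets borel" "uniformly_distributed P (\<lambda>n. \<phi> (k n))"
    and p: "measure P (closure (\<phi> ` S)) \<le> p" "measure P (closure (\<phi> ` (- S))) \<le> 1 - p"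
  shows "mean (\<lambda>n. indicator S (k n)) \<longlonglongrightarrow> p"
proof -
  have upper: "\<forall>\<^sub>F N in sequentially. mean (\<lambda>n. indicator T (k n)) N < q + e"
    if "measure P (closure (\<phi> ` T)) \<le> q" "e > 0" for T q and e :: real
    using uniformly_distributed_closed_upper[OF assms(1-3) closed_closure \<open>e > 0\<close>, of "\<phi> ` T"]
  proof eventually_elim
    case (elim N)
    have "mean (\<lambda>n. indicator T (k n)) N \<le> mean (\<lambda>n. indicator (closure (\<phi> ` T)) (\<phi> (k n))) N"
      by (intro mean_mono) (use closure_subset in \<open>fastforce simp: indicator_def\<close>)
    with elim that show ?case by linarith
  qed
  from upper p show ?thesis by (intro mean_indicator_tendstoI) auto
qed

text \<open>Passing to the closure adds only frontier points, a null set; \<open>S\<close> and its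
  complement share their frontier, so both closure bounds hold with
  \<open>p = measure P S\<close>.\<close>

lemma mean_indicator_tendsto_continuity_set:
  fixes P :: "'a::metric_space measure"
  assumes "prob_space P" "sets P = sets borel" "uniformly_distributed P a"
    and S: "S \<in> sets borel" "measure P (frontier S) = 0"
  shows "mean (\<lambda>n. indicator S (a n)) \<longlonglongrightarrow> measure P S"
proof -
  interpret P: prob_space P by fact
  have *: "measure P (closure T) \<le> measure P T" if "T \<in> sets borel" "measure P (frontier T) = 0" for T
  proof -
    have "measure P (closure T) \<le> measure P (T \<union> frontier T)"
      using that assms(2) by (intro P.finite_measure_mono) (use interior_subset closure_subset in \<open>auto simp: frontier_def\<close>)
    also have "\<dots> \<le> measure P T + measure P (frontier T)"
      using that assms(2) by (intro measure_Un_le) auto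
    finally show ?thesis using that by simp
  qed
  have "measure P (- S) = 1 - measure P S"
    using P.prob_compl[of S] S assms(2) sets_eq_imp_space_eq[OF assms(2)] by (simp add: Compl_eq_Diff_UNIV)
  then show ?thesis
    using assms *[of S] *[of "- S"]
    by (intro mean_indicator_tendsto_closures[where \<phi> = "\<lambda>y. y" and P = P]) (auto simp: frontier_complement)
qed

subsection \<open>Uniformly distributed sequences in a compact space\<close>

text \<open>Compactness gives finitely many balls of radius \<open>r\<close> covering the space;
  each point is sent to the centre of a ball that contains it, with ties resolved so that the level
  sets are Borel.\<close>

lemma exists_finite_quantizer:
  assumes "compact (UNIV :: 'a::metric_space set)" "r > 0"
  obtains q :: "'a::metric_space \<Rightarrow> 'a" where "finite (range q)" "\<And>c. q -` {c} \<in> sets borel" "\<And>y. dist (q y) y < r"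
proof -
  \<comment> \<open>Induction on the set of centres: a new centre \<open>c\<close> overrides the old
    map on its ball. Closeness is claimed only inside the balls, so an arbitrary constant starts the
    induction.\<close>
  have ex: "\<exists>q :: 'a \<Rightarrow> 'a. finite (range q) \<and> (\<forall>c. q -` {c} \<in> sets borel) \<and>
          (\<forall>y. (\<exists>c\<in>K. dist c y < r) \<longrightarrow> dist (q y) y < r)" if "finite K" for K
    using that
  proof (induction K rule: finite_induct)
    case empty
    show ?case by (intro exI[of _ "\<lambda>_. undefined"]) simp
  next
    case (insert c K)
    then obtain q :: "'a \<Rightarrow> 'a" where q: "finite (range q)" "\<And>c. q -` {c} \<in> sets borel"
      "\<And>y. (\<exists>c\<in>K. dist c y < r) \<Longrightarrow> dist (q y) y < r" by blast
    let ?q = "\<lambda>y. if y \<in> ball c r then c else q y"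
    have "range ?q \<subseteq> insert c (range q)" by auto
    then have fin: "finite (range ?q)" using q(1) by (meson finite_insert finite_subset)
    have bor: "?q -` {d} \<in> sets borel" for d
    proof -
      have "?q -` {d} = (if d = c then ball c r else {}) \<union> (q -` {d} - ball c r)"
        by (auto split: if_splits)
      then show ?thesis using q(2)[of d] by simp
    qed
    have close: "dist (?q y) y < r" if "\<exists>c\<in>insert c K. dist c y < r" for y
      using q(3)[of y] that by auto
    show ?case by (intro exI[of _ ?q] conjI allI impI fin bor close)
  qed
  have "(UNIV :: 'a set) \<subseteq> (\<Union>c\<in>UNIV. ball c r)"
  proof
    fix y :: 'a
    show "y \<in> (\<Union>c\<in>UNIV. ball c r)" using assms(2) by (intro UN_I[of y]) simp_all
  qed
  then obtain K :: "'a set" where K: "finite K" "UNIV \<subseteq> (\<Union>c\<in>K. ball c r)"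
    by (rule compactE_image[OF assms(1) open_ball])
  have near: "\<exists>c\<in>K. dist c y < r" for y
    using subsetD[OF K(2) UNIV_I, of y] by simp
  obtain q :: "'a \<Rightarrow> 'a" where q: "finite (range q)" "\<And>c. q -` {c} \<in> sets borel"
    "\<And>y. (\<exists>c\<in>K. dist c y < r) \<Longrightarrow> dist (q y) y < r"
    using ex[OF K(1)] by blast
  show thesis by (rule that[OF q(1,2) q(3)[OF near]])
qed

text \<open>By uniform continuity a continuous \<open>g\<close> is within \<open>e / 3\<close> of
  the step function \<open>g (q m y)\<close> for large \<open>m\<close>. The averages of the step
  function converge because they involve finitely many level-set frequencies; the two replacements,
  in the average and in the integral, cost \<open>e / 3\<close> each.\<close>

lemma uniformly_distributedI_quantizers:
  fixes P :: "'a::metric_space measure"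
  assumes "compact (UNIV :: 'a set)" "prob_space P" "sets P = sets borel"
    and q: "\<And>m. finite (range (q m))" "\<And>m c. q m -` {c} \<in> sets borel"
      "\<And>m y. dist (q m y) y < 1 / real (Suc m)"
    and freq: "\<And>m c. mean (\<lambda>n. indicator (q m -` {c}) (a n)) \<longlonglongrightarrow> measure P (q m -` {c})"
  shows "uniformly_distributed P a"
  unfolding uniformly_distributed_iff_mean
proof (intro allI impI tendstoI)
  fix g :: "'a \<Rightarrow> real" and e :: real
  assume g: "continuous_on UNIV g" and e: "e > 0"
  interpret P: prob_space P by fact
  have "uniformly_continuous_on UNIV g"
    using g assms(1) compact_uniformly_continuous by blast
  moreover have "0 < e / 3" using e by simp
  ultimately obtain d where d: "d > 0" "\<And>y z. dist z y < d \<Longrightarrow> dist (g z) (g y) < e / 3"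
    by (rule uniformly_continuous_onE) simp_all
  obtain m where m: "1 / real (Suc m) < d" using d(1) by (rule nat_approx_posE)
  define h where "h y = g (q m y)" for y
  have gh: "\<bar>g y - h y\<bar> \<le> e / 3" for y
    using d(2)[of "q m y" y] q(3)[of m y] m unfolding h_def dist_real_def by linarith
  have h_eq: "h = (\<lambda>y. \<Sum>c\<in>range (q m). g c * indicator (q m -` {c}) y)"
  proof
    fix y
    have "(\<Sum>c\<in>range (q m). g c * indicator (q m -` {c}) y) = (\<Sum>c\<in>range (q m). if c = q m y then g c else 0)"
      by (intro sum.cong) auto
    then show "h y = (\<Sum>c\<in>range (q m). g c * indicator (q m -` {c}) y)"
      using q(1)[of m] by (simp add: h_def)
  qed
  have q_sets [measurable]: "q m -` {c} \<in> sets P" for c using q(2) assms(3) by simp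
  have ind_int: "integrable P (\<lambda>y. g c * indicator (q m -` {c}) y)" for c
    using q_sets[of c] by (intro integrable_mult_right integrable_real_indicator) (auto simp: P.emeasure_eq_measure)
  then have int_h: "integrable P h"
    unfolding h_eq by (rule Bochner_Integration.integrable_sum)
  have integral_h: "integral\<^sup>L P h = (\<Sum>c\<in>range (q m). g c * measure P (q m -` {c}))"
    unfolding h_eq using q_sets by (subst Bochner_Integration.integral_sum[OF ind_int]) simp
  have "mean (\<lambda>n. h (a n)) = (\<lambda>N. \<Sum>c\<in>range (q m). g c * mean (\<lambda>n. indicator (q m -` {c}) (a n)) N)"
    unfolding h_eq mean_sum_scaled ..
  then have "mean (\<lambda>n. h (a n)) \<longlonglongrightarrow> integral\<^sup>L P h"
    unfolding integral_h by (simp only:) (intro tendsto_sum tendsto_mult_left freq)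
  from tendstoD[OF this, of "e / 3"] e
  have ev: "\<forall>\<^sub>F N in sequentially. dist (mean (\<lambda>n. h (a n)) N) (integral\<^sup>L P h) < e / 3" by simp
  have mean_close: "\<bar>mean (\<lambda>n. g (a n)) N - mean (\<lambda>n. h (a n)) N\<bar> \<le> e / 3" for N
    unfolding mean_diff[symmetric] using gh e by (intro abs_mean_le) auto
  have integral_close: "\<bar>integral\<^sup>L P g - integral\<^sup>L P h\<bar> \<le> e / 3"
  proof -
    have g_meas: "g \<in> borel_measurable P"
      using borel_measurable_continuous_onI[OF g] assms(3) measurable_cong_sets by blast
    \<comment> \<open>Compactness also provides the bound that makes \<open>g\<close>
      integrable.\<close>
    have "bounded (range g)"
      using assms(1) g compact_continuous_image compact_imp_bounded by blast
    then obtain B where "\<And>y. \<bar>g y\<bar> \<le> B" by (auto simp: bounded_iff)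
    then have int_g: "integrable P g"
      using g_meas by (intro P.integrable_const_bound[of _ B]) auto
    have "\<bar>integral\<^sup>L P g - integral\<^sup>L P h\<bar> = \<bar>\<integral>y. g y - h y \<partial>P\<bar>"
      using int_g int_h by simp
    also have "\<dots> \<le> (\<integral>y. \<bar>g y - h y\<bar> \<partial>P)" by (rule integral_abs_bound)
    also have "\<dots> \<le> e / 3"
      using int_g int_h gh by (intro P.integral_le_const) auto
    finally show ?thesis .
  qed
  from ev show "\<forall>\<^sub>F N in sequentially. dist (mean (\<lambda>n. g (a n)) N) (integral\<^sup>L P g) < e"
  proof eventually_elim
    case (elim N)
    with mean_close[of N] integral_close show ?case unfolding dist_real_def by linarith
  qed
qed

text \<open>Uniform distribution alone does not fix the frequency of \<open>B\<close>, whose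
  frontier may carry mass. Hence \<open>B\<close> joins the countable family of quantizer level sets
  whose frequencies a random sample attains.\<close>

lemma exists_uniformly_distributed_frequency:
  fixes P :: "'a::metric_space measure"
  assumes "compact (UNIV :: 'a set)" "prob_space P" "sets P = sets borel" "B \<in> sets borel"
  obtains a where "uniformly_distributed P a" "mean (\<lambda>n. indicator B (a n)) \<longlonglongrightarrow> measure P B"
proof -
  have "\<exists>q :: 'a \<Rightarrow> 'a. finite (range q) \<and> (\<forall>c. q -` {c} \<in> sets borel) \<and> (\<forall>y. dist (q y) y < 1 / real (Suc m))" for m
  proof -
    have "0 < 1 / real (Suc m)" by simp
    then show ?thesis by (rule exists_finite_quantizer[OF assms(1)]) blast
  qed
  then obtain q :: "nat \<Rightarrow> 'a \<Rightarrow> 'a" where q: "\<And>m. finite (range (q m))" "\<And>m c. q m -` {c} \<in> sets borel"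
      "\<And>m y. dist (q m y) y < 1 / real (Suc m)"
    by metis
  define \<S> where "\<S> = insert B (\<Union>m. (\<lambda>c. q m -` {c}) ` range (q m))"
  have "countable \<S>" unfolding \<S>_def using q(1) by (auto intro: countable_finite)
  moreover have "\<S> \<subseteq> sets P" using q(2) assms(3,4) by (auto simp: \<S>_def)
  ultimately obtain a where a: "\<And>S. S \<in> \<S> \<Longrightarrow> mean (\<lambda>n. indicator S (a n)) \<longlonglongrightarrow> measure P S"
    using exists_sequence_frequencies[OF assms(2), of \<S>] by blast
  have "mean (\<lambda>n. indicator (q m -` {c}) (a n)) \<longlonglongrightarrow> measure P (q m -` {c})" for m c
  proof (cases "c \<in> range (q m)")
    case True
    then show ?thesis by (intro a) (auto simp: \<S>_def)
  next
    \<comment> \<open>Values outside the range have empty level sets; leaving them out of the family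
      keeps it countable.\<close>
    case False
    then have "q m -` {c} = {}" by auto
    then show ?thesis by (simp add: mean_def[abs_def])
  qed
  then have "uniformly_distributed P a"
    by (rule uniformly_distributedI_quantizers[OF assms(1-3) q])
  then show thesis using that a[of B] by (simp add: \<S>_def)
qed

text \<open>Moving each term by less than \<open>1 / (n + 1)\<close> preserves uniform distribution,
  and since \<open>k\<close> lands in \<open>S\<close> whenever the original term lies in the
  closure, \<open>S\<close> is visited at least as often. Convergence of the frequency of
  \<open>S\<close> is not asserted, so the bound is stated for any limit \<open>p\<close> it may
  have.\<close>

lemma exists_uniformly_distributed_closure_frequency:
  fixes P :: "'a::metric_space measure" and \<phi> :: "nat \<Rightarrow> 'a"
  assumes "compact (UNIV :: 'a set)" "prob_space P" "sets P = sets borel" "closure (range \<phi>) = UNIV"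
  obtains k where "uniformly_distributed P (\<lambda>n. \<phi> (k n))"
    "\<And>p. mean (\<lambda>n. indicator S (k n)) \<longlonglongrightarrow> p \<Longrightarrow> measure P (closure (\<phi> ` S)) \<le> p"
proof -
  let ?B = "closure (\<phi> ` S)"
  obtain a where a: "uniformly_distributed P a" "mean (\<lambda>n. indicator ?B (a n)) \<longlonglongrightarrow> measure P ?B"
    using exists_uniformly_distributed_frequency[OF assms(1-3), of ?B] by auto
  have pos: "0 < 1 / real (Suc n)" for n by simp
  have "\<exists>j. dist (\<phi> j) (a n) < 1 / real (Suc n) \<and> (a n \<in> ?B \<longrightarrow> j \<in> S)" for n
  proof (cases "a n \<in> ?B")
    case True
    then obtain z where "z \<in> \<phi> ` S" "dist z (a n) < 1 / real (Suc n)"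
      unfolding closure_approachable using pos by blast
    then show ?thesis by blast
  next
    case False
    have "a n \<in> closure (range \<phi>)" using assms(4) by simp
    then obtain z where "z \<in> range \<phi>" "dist z (a n) < 1 / real (Suc n)"
      unfolding closure_approachable using pos by blast
    then show ?thesis using False by blast
  qed
  then obtain k where k: "\<And>n. dist (\<phi> (k n)) (a n) < 1 / real (Suc n)" "\<And>n. a n \<in> ?B \<Longrightarrow> k n \<in> S"
    by metis
  have dist0: "(\<lambda>n. dist (\<phi> (k n)) (a n)) \<longlonglongrightarrow> 0"
    by (rule real_tendsto_sandwich[OF _ _ tendsto_const LIMSEQ_inverse_real_of_nat])
      (use k(1) in \<open>auto simp: inverse_eq_divide intro!: always_eventually less_imp_le\<close>)
  have "uniformly_distributed P (\<lambda>n. \<phi> (k n))"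
    unfolding uniformly_distributed_iff_mean
  proof (intro allI impI)
    fix g :: "'a \<Rightarrow> real" assume g: "continuous_on UNIV g"
    then have "uniformly_continuous_on UNIV g"
      using assms(1) compact_uniformly_continuous by blast
    from this[unfolded uniformly_continuous_on_sequentially, rule_format, of "\<lambda>n. \<phi> (k n)" a] dist0
    have "(\<lambda>n. dist (g (\<phi> (k n))) (g (a n))) \<longlonglongrightarrow> 0" by simp
    then have "(\<lambda>n. g (\<phi> (k n)) - g (a n)) \<longlonglongrightarrow> 0"
      by (simp add: dist_real_def tendsto_rabs_zero_iff)
    moreover have "mean (\<lambda>n. g (a n)) \<longlonglongrightarrow> integral\<^sup>L P g"
      using a(1) g by (simp add: uniformly_distributed_iff_mean)
    ultimately show "mean (\<lambda>n. g (\<phi> (k n))) \<longlonglongrightarrow> integral\<^sup>L P g"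
      by (rule mean_cong_lim)
  qed
  moreover have "measure P ?B \<le> p" if "mean (\<lambda>n. indicator S (k n)) \<longlonglongrightarrow> p" for p
  proof (rule LIMSEQ_le[OF a(2) that], intro exI allI impI)
    show "mean (\<lambda>n. indicator ?B (a n)) N \<le> mean (\<lambda>n. indicator S (k n)) N" for N
      using k(2) by (intro mean_mono) (auto simp: indicator_def)
  qed
  ultimately show thesis using that by blast
qed

subsection \<open>Riemann integrability\<close>

text \<open>Exposes the value that \<open>riemann_integrable\<close> hides behind a quantifier, so
  that it can be negated and identified with the gauge integral.\<close>

definition has_riemann_integral :: "(real \<Rightarrow> real) \<Rightarrow> real \<Rightarrow> real \<Rightarrow> real \<Rightarrow> bool" where
  "has_riemann_integral f J a b \<longleftrightarrow>
     (\<forall>\<epsilon>>0. \<exists>\<delta>>0. \<forall>p. p tagged_division_of {a..b} \<and> (\<forall>(t, K)\<in>p. measure lborel K < \<delta>) \<longrightarrow>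
        \<bar>(\<Sum>(t, K)\<in>p. measure lborel K * f t) - J\<bar> < \<epsilon>)"

lemma riemann_integrable_iff: "riemann_integrable f a b \<longleftrightarrow> (\<exists>J. has_riemann_integral f J a b)"
  by (simp add: riemann_integrable_def has_riemann_integral_def)

text \<open>Turns an upper estimate proved for all Riemann integrable functions into a lower
  one.\<close>

lemma has_riemann_integral_minus:
  assumes "has_riemann_integral f J a b"
  shows "has_riemann_integral (\<lambda>t. - f t) (- J) a b"
proof -
  have "\<bar>(\<Sum>(t, K)\<in>p. measure lborel K * - f t) - - J\<bar> = \<bar>(\<Sum>(t, K)\<in>p. measure lborel K * f t) - J\<bar>"
    for p :: "(real \<times> real set) set"
    by (simp add: case_prod_unfold sum_negf)
  then show ?thesis using assms by (simp only: has_riemann_integral_def)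
qed

text \<open>A mesh bound \<open>d\<close> becomes the constant gauge of balls of radius
  \<open>d / 2\<close>: both endpoints of a fine cell lie in such a ball, so the cell is shorter
  than \<open>d\<close>.\<close>

lemma has_riemann_integral_imp_has_integral:
  assumes "has_riemann_integral f J a b"
  shows "(f has_integral J) {a..b}"
  unfolding has_integral cbox_interval[symmetric]
proof (intro allI impI)
  fix e :: real assume "e > 0"
  then obtain d where d: "d > 0"
    "\<And>p. p tagged_division_of {a..b} \<Longrightarrow> (\<forall>(t, K)\<in>p. measure lborel K < d) \<Longrightarrow>
        \<bar>(\<Sum>(t, K)\<in>p. measure lborel K * f t) - J\<bar> < e"
    using assms unfolding has_riemann_integral_def by meson
  show "\<exists>\<gamma>. gauge \<gamma> \<and> (\<forall>p. p tagged_division_of cbox a b \<and> \<gamma> fine p \<longrightarrow>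
      norm ((\<Sum>(t, K)\<in>p. measure lborel K *\<^sub>R f t) - J) < e)"
  proof (intro exI[of _ "\<lambda>t. ball t (d / 2)"] conjI allI impI)
    show "gauge (\<lambda>t. ball t (d / 2))" using d(1) by auto
    fix p assume p: "p tagged_division_of cbox a b \<and> (\<lambda>t. ball t (d / 2)) fine p"
    have "measure lborel K < d" if tK: "(t, K) \<in> p" for t K
    proof -
      obtain u v where uv: "K = cbox u v" using p tK by blast
      have "K \<subseteq> ball t (d / 2)" using p tK by (auto dest: fineD)
      then have "v - u < d" if "u \<le> v"
      proof -
        have "u \<in> ball t (d / 2)" "v \<in> ball t (d / 2)"
          using \<open>K \<subseteq> ball t (d / 2)\<close> uv that by auto
        then have "\<bar>t - u\<bar> < d / 2" "\<bar>t - v\<bar> < d / 2" by (simp_all only: mem_ball dist_real_def)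
        then show ?thesis by linarith
      qed
      then show ?thesis using uv d(1) by (cases "u \<le> v") auto
    qed
    then show "norm ((\<Sum>(t, K)\<in>p. measure lborel K *\<^sub>R f t) - J) < e"
      using d(2)[of p] p by (auto simp: cbox_interval)
  qed
qed

text \<open>If the mesh is below a modulus of uniform continuity for \<open>e / 2\<close>, each cell
  contributes an error of at most \<open>e / 2\<close> times its length, and the lengths sum to
  1.\<close>

lemma continuous_on_imp_has_riemann_integral:
  assumes f: "continuous_on {0..1} f"
  shows "has_riemann_integral f (integral {0..1} f) 0 1"
  unfolding has_riemann_integral_def
proof (intro allI impI)
  fix e :: real assume e: "e > 0"
  have "uniformly_continuous_on {0..1} f"
    using f by (intro compact_uniformly_continuous) auto
  moreover have "0 < e / 2" using e by simp
  ultimately obtain d where d: "d > 0"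
    "\<And>s t. s \<in> {0..1} \<Longrightarrow> t \<in> {0..1} \<Longrightarrow> \<bar>t - s\<bar> < d \<Longrightarrow> \<bar>f t - f s\<bar> < e / 2"
    unfolding dist_real_def[symmetric] by (rule uniformly_continuous_onE) auto
  have f_int: "f integrable_on cbox 0 1" using f by (intro integrable_continuous) (simp add: cbox_interval)
  show "\<exists>\<delta>>0. \<forall>p. p tagged_division_of {0..1} \<and> (\<forall>(t, K)\<in>p. measure lborel K < \<delta>) \<longrightarrow>
      \<bar>(\<Sum>(t, K)\<in>p. measure lborel K * f t) - integral {0..1} f\<bar> < e"
  proof (intro exI[of _ d] conjI allI impI d(1))
    fix p :: "(real \<times> real set) set"
    assume "p tagged_division_of {0..1} \<and> (\<forall>(t, K)\<in>p. measure lborel K < d)"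
    then have p: "p tagged_division_of cbox 0 1" and small: "\<And>t K. (t, K) \<in> p \<Longrightarrow> measure lborel K < d"
      unfolding cbox_interval by auto
    have local_bound: "\<bar>measure lborel K * f t - integral K f\<bar> \<le> e / 2 * measure lborel K" if tK: "(t, K) \<in> p" for t K
    proof -
      obtain u v where uv: "K = cbox u v" using p tK by blast
      have tK': "t \<in> K" and sub: "K \<subseteq> {0..1}" using p tK by (auto simp: cbox_interval)
      have le: "u \<le> v" and len: "v - u < d" using small[OF tK] uv tK' by auto
      have "f integrable_on cbox u v" using sub uv by (intro integrable_on_subcbox[OF f_int]) (simp add: cbox_interval)
      \<comment> \<open>The error on a cell is itself the integral of \<open>f t - f s\<close>,
        whose integrand is small throughout the cell.\<close>
      then have "((\<lambda>s. f t - f s) has_integral measure lborel K * f t - integral K f) (cbox u v)"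
        using has_integral_diff[OF has_integral_const[of "f t" u v] integrable_integral] uv by simp
      moreover have "norm (f t - f s) \<le> e / 2" if "s \<in> cbox u v" for s
      proof -
        have "s \<in> {0..1}" "t \<in> {0..1}" using that tK' sub uv by blast+
        moreover have "\<bar>t - s\<bar> < d" using that tK' len uv by auto
        ultimately have "\<bar>f t - f s\<bar> < e / 2" by (rule d(2))
        then show ?thesis by simp
      qed
      ultimately show ?thesis
        using has_integral_bound[of "e / 2" "\<lambda>s. f t - f s"] e uv by auto
    qed
    have "integral {0..1} f = (\<Sum>(t, K)\<in>p. integral K f)"
      using integral_combine_tagged_division_topdown[OF f_int p] by (simp add: cbox_interval)
    then have "\<bar>(\<Sum>(t, K)\<in>p. measure lborel K * f t) - integral {0..1} f\<bar> = \<bar>\<Sum>(t, K)\<in>p. measure lborel K * f t - integral K f\<bar>"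
      by (simp add: sum_subtractf case_prod_unfold)
    also have "\<dots> \<le> (\<Sum>(t, K)\<in>p. e / 2 * measure lborel K)"
      using local_bound by (intro order_trans[OF sum_abs] sum_mono) auto
    also have "\<dots> = e / 2 * (\<Sum>(t, K)\<in>p. measure lborel K)"
      by (simp add: sum_distrib_left case_prod_unfold)
    also have "(\<Sum>(t, K)\<in>p. measure lborel K) = 1"
      using additive_content_tagged_division[OF p] by simp
    finally show "\<bar>(\<Sum>(t, K)\<in>p. measure lborel K * f t) - integral {0..1} f\<bar> < e" using e by simp
  qed
qed

lemma continuous_imp_riemann_integrable:
  "continuous_on {0..1} f \<Longrightarrow> riemann_integrable f 0 1"
  using continuous_on_imp_has_riemann_integral riemann_integrable_iff by blast

section \<open>Regular partitions and step majorants\<close>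

text \<open>Translates tagged divisions into sums over indices for \<open>n\<close> equal cells with
  one tag each. A tagged division is a set of pairs, so the cells must be shown distinct before the
  sum can be reindexed.\<close>

lemma regular_tagged_division:
  fixes t :: "nat \<Rightarrow> real"
  assumes n: "n \<ge> 1" and t: "\<And>i. i < n \<Longrightarrow> t i \<in> {real i / real n..real (Suc i) / real n}"
  defines "p \<equiv> (\<lambda>i. (t i, {real i / real n..real (Suc i) / real n})) ` {..<n}"
  shows "p tagged_division_of {0..1}" "\<forall>(s, K)\<in>p. measure lborel K = 1 / real n"
    "(\<Sum>(s, K)\<in>p. measure lborel K * f s) = (\<Sum>i<n. f (t i)) / real n"
proof -
  define I where "I i = {real i / real n..real (Suc i) / real n}" for i :: nat
  have n0: "real n > 0" using n by simp
  have content_I: "measure lborel (I i) = 1 / real n" for i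
  proof -
    have "real i / real n \<le> real (Suc i) / real n" by (rule divide_right_mono) auto
    then show ?thesis by (simp add: I_def diff_divide_distrib[symmetric])
  qed
  have p: "p = (\<lambda>i. (t i, I i)) ` {..<n}" by (simp add: p_def I_def)
  have I_inj: "i = j" if "I i = I j" for i j
  proof -
    have "real i / real n \<le> real (Suc i) / real n" for i by (rule divide_right_mono) auto
    then have "real i / real n = real j / real n" using that unfolding I_def by (metis Icc_eq_Icc)
    then show ?thesis using n0 by simp
  qed
  then have inj: "inj_on (\<lambda>i. (t i, I i)) {..<n}" by (auto simp: inj_on_def)
  show "\<forall>(s, K)\<in>p. measure lborel K = 1 / real n" using content_I by (auto simp: p)
  show "(\<Sum>(s, K)\<in>p. measure lborel K * f s) = (\<Sum>i<n. f (t i)) / real n"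
    unfolding p by (subst sum.reindex[OF inj]) (simp add: content_I sum_divide_distrib)
  have I_sub: "I i \<subseteq> {0..1}" if "i < n" for i
  proof
    fix y assume "y \<in> I i"
    then have "real i / real n \<le> y" "y \<le> real (Suc i) / real n" by (simp_all add: I_def)
    moreover have "real (Suc i) / real n \<le> 1" using that n0 by (simp add: divide_le_eq_1)
    moreover have "0 \<le> real i / real n" by simp
    ultimately have "0 \<le> y" "y \<le> 1" by linarith+
    then show "y \<in> {0..1}" by simp
  qed
  show "p tagged_division_of {0..1}"
  proof (rule tagged_division_ofI)
    show "finite p" by (simp add: p)
    fix s K assume "(s, K) \<in> p"
    then obtain i where i: "i < n" "s = t i" "K = I i" by (auto simp: p)
    show "s \<in> K" using t i by (simp add: I_def)
    show "K \<subseteq> {0..1}" using i I_sub by simp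
    show "\<exists>a b. K = cbox a b" using i(3) by (auto simp: I_def)
    fix s' K' assume "(s', K') \<in> p" and ne: "(s, K) \<noteq> (s', K')"
    then obtain j where j: "j < n" "s' = t j" "K' = I j" by (auto simp: p)
    have "i \<noteq> j" using ne i j by auto
    then consider "Suc i \<le> j" | "Suc j \<le> i" by linarith
    then have "real (Suc i) / real n \<le> real j / real n \<or> real (Suc j) / real n \<le> real i / real n"
      by cases (intro disjI1 disjI2 divide_right_mono; simp)+
    then show "interior K \<inter> interior K' = {}"
      unfolding i(3) j(3) I_def interior_atLeastAtMost_real by auto
  next
    have "\<exists>i<n. y \<in> I i" if y: "y \<in> {0..1}" for y
    proof (cases "y = 1")
      \<comment> \<open>At the right end the floor of \<open>n * y\<close> would be
        \<open>n\<close>, one past the last index, so the point goes to cell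
        \<open>n - 1\<close>.\<close>
      case True
      then show ?thesis using n by (intro exI[of _ "n - 1"]) (simp add: I_def divide_le_eq_1)
    next
      case False
      define i where "i = nat \<lfloor>real n * y\<rfloor>"
      have bounds: "real i \<le> real n * y" "real n * y < real (Suc i)"
      proof -
      have "real i = real_of_int \<lfloor>real n * y\<rfloor>" using y n0 by (simp add: i_def)
      then show "real i \<le> real n * y" "real n * y < real (Suc i)" by linarith+
    qed
      have "real n * y < real n" using False y n0 by simp
      with bounds have "i < n" by linarith
      moreover have "y \<in> I i" using bounds n0 by (simp add: I_def field_simps)
      ultimately show ?thesis by blast
    qed
    then have "{0..1} \<subseteq> (\<Union>i<n. I i)" by blast
    moreover have "(\<Union>i<n. I i) \<subseteq> {0..1}" using I_sub by (intro UN_least) simp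
    moreover have "\<Union>{K. \<exists>s. (s, K) \<in> p} = (\<Union>i<n. I i)" unfolding p by auto
    ultimately show "\<Union>{K. \<exists>s. (s, K) \<in> p} = {0..1}" by simp
  qed
qed

text \<open>Tags at which \<open>f\<close> nearly attains its supremum on each cell turn a Riemann
  sum into an upper Darboux sum up to \<open>e\<close>. The suprema are finite because Riemann
  integrability forces boundedness.\<close>

lemma riemann_sum_of_near_suprema:
  assumes f: "has_riemann_integral f J 0 1" and e: "e > 0"
  obtains n :: nat and t :: "nat \<Rightarrow> real" where "n \<ge> 1"
    "\<And>i s. i < n \<Longrightarrow> s \<in> {real i / real n..real (Suc i) / real n} \<Longrightarrow> f s \<le> f (t i) + e"
    "(\<Sum>i<n. f (t i)) / real n < J + e"
proof -
  obtain d where d: "d > 0"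
    "\<And>p. p tagged_division_of {0..1} \<Longrightarrow> (\<forall>(t, K)\<in>p. measure lborel K < d) \<Longrightarrow>
        \<bar>(\<Sum>(t, K)\<in>p. measure lborel K * f t) - J\<bar> < e"
    using f e unfolding has_riemann_integral_def by meson
  obtain m where m: "1 / real (Suc m) < d" using d(1) by (rule nat_approx_posE)
  define n where "n = Suc m"
  define I where "I i = {real i / real n..real (Suc i) / real n}" for i :: nat
  \<comment> \<open>The estimate holds for every choice of tags; this freedom yields first
    boundedness and then the tags near the suprema.\<close>
  have sums: "\<bar>(\<Sum>i<n. f (t i)) / real n - J\<bar> < e" if "\<And>i. i < n \<Longrightarrow> t i \<in> I i" for t
  proof -
    let ?p = "(\<lambda>i. (t i, {real i / real n..real (Suc i) / real n})) ` {..<n}"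
    have n: "n \<ge> 1" and t: "\<And>i. i < n \<Longrightarrow> t i \<in> {real i / real n..real (Suc i) / real n}"
      using that unfolding n_def I_def by simp_all
    have "\<forall>(t, K)\<in>?p. measure lborel K < d"
      using regular_tagged_division(2)[OF n t] m by (auto simp: n_def)
    then have "\<bar>(\<Sum>(t, K)\<in>?p. measure lborel K * f t) - J\<bar> < e"
      by (intro d(2) regular_tagged_division(1)[OF n t])
    moreover have "(\<Sum>(t, K)\<in>?p. measure lborel K * f t) = (\<Sum>i<n. f (t i)) / real n"
      by (rule regular_tagged_division(3)[OF n t])
    ultimately show ?thesis by (simp only:)
  qed
  \<comment> \<open>Left endpoints serve as default tags in the cells whose tag is not being
    moved.\<close>
  have left: "real i / real n \<in> I i" for i
    using divide_right_mono[of "real i" "real (Suc i)" "real n"] by (simp add: I_def)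
  \<comment> \<open>Moving the single tag in \<open>I i\<close> keeps the Riemann sum within \<open>e\<close> of \<open>J\<close>, which bounds \<open>f\<close> there.\<close>
  have bdd: "bdd_above (f ` I i)" if i: "i < n" for i
  proof (rule bdd_aboveI2)
    fix s assume s: "s \<in> I i"
    define t where "t = (\<lambda>j. if j = i then s else real j / real n)"
    have "\<bar>(\<Sum>j<n. f (t j)) / real n - J\<bar> < e"
      using s left by (intro sums) (simp add: t_def)
    then have "(\<Sum>j<n. f (t j)) / real n \<le> J + e" by linarith
    then have "(\<Sum>j<n. f (t j)) \<le> (J + e) * real n" by (simp add: n_def pos_divide_le_eq)
    moreover have "(\<Sum>j<n. f (t j)) = f s + (\<Sum>j\<in>{..<n} - {i}. f (real j / real n))"
      using i by (subst sum.remove[of _ i]) (auto simp: t_def intro!: sum.cong)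
    ultimately show "f s \<le> (J + e) * real n - (\<Sum>j\<in>{..<n} - {i}. f (real j / real n))" by linarith
  qed
  have "\<exists>t\<in>I i. \<forall>s\<in>I i. f s \<le> f t + e" if i: "i < n" for i
  proof -
    have "f ` I i \<noteq> {}" using left by blast
    then obtain t where "t \<in> I i" "Sup (f ` I i) - e < f t"
      using less_cSup_iff[OF _ bdd[OF i], of "Sup (f ` I i) - e"] e by auto
    moreover have "f s \<le> Sup (f ` I i)" if "s \<in> I i" for s
      using that bdd[OF i] by (intro cSup_upper) auto
    ultimately show ?thesis by force
  qed
  then obtain t where t: "\<And>i. i < n \<Longrightarrow> t i \<in> I i" "\<And>i s. i < n \<Longrightarrow> s \<in> I i \<Longrightarrow> f s \<le> f (t i) + e"
    by metis
  have "(\<Sum>i<n. f (t i)) / real n < J + e" using sums[OF t(1)] by linarith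
  then show thesis using t(2) that[of n t] by (simp add: n_def I_def)
qed

text \<open>Near-supremum tags give a step function above \<open>f\<close> with integral below
  \<open>J + e\<close>, and its averages converge because interval frequencies do.\<close>

lemma riemann_mean_upper:
  assumes f: "has_riemann_integral f J 0 1" and e: "e > 0" and u: "range u \<subseteq> {0..1}"
    and freq: "\<And>I. is_interval I \<Longrightarrow> I \<subseteq> {0..1} \<Longrightarrow> mean (\<lambda>n. indicator I (u n)) \<longlonglongrightarrow> measure lborel I"
  shows "\<forall>\<^sub>F N in sequentially. mean (\<lambda>n. f (u n)) N < J + e"
proof -
  \<comment> \<open>One half of \<open>e\<close> raises the tag values to upper bounds on the cells,
    the other separates the Riemann sum from \<open>J\<close>.\<close>
  obtain n :: nat and t where n: "n \<ge> 1"
    and t: "\<And>i s. i < n \<Longrightarrow> s \<in> {real i / real n..real (Suc i) / real n} \<Longrightarrow> f s \<le> f (t i) + e / 2"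
    and sum_t: "(\<Sum>i<n. f (t i)) / real n < J + e / 2"
    using riemann_sum_of_near_suprema[OF f, of "e / 2"] e by auto
  \<comment> \<open>Half-open cells make a partition; the extra cell \<open>H n\<close> is the null set \<open>{1}\<close>.\<close>
  define H where "H i = {real i / real n..<real (Suc i) / real n} \<inter> {0..1}" for i :: nat
  \<comment> \<open>The near-supremum bound covers only cells with index below \<open>n\<close>; on
    the extra cell the value \<open>f 1\<close> is exact.\<close>
  define c where "c i = (if i = n then f 1 else f (t i) + e / 2)" for i
  have n0: "real n > 0" using n by simp
  \<comment> \<open>The floor determines the cell, so exactly one indicator is nonzero at each point
    of the unit interval.\<close>
  have mem_H: "y \<in> H i \<longleftrightarrow> i = nat \<lfloor>real n * y\<rfloor>" if "y \<in> {0..1}" for y i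
  proof -
    have "y \<in> H i \<longleftrightarrow> real i \<le> real n * y \<and> real n * y < real (Suc i)"
      using that n0 by (auto simp: H_def field_simps)
    also have "\<dots> \<longleftrightarrow> \<lfloor>real n * y\<rfloor> = int i"
      by (auto simp: floor_eq_iff)
    also have "\<dots> \<longleftrightarrow> i = nat \<lfloor>real n * y\<rfloor>" using that n0 by auto
    finally show ?thesis .
  qed
  have bound: "f y \<le> (\<Sum>i\<le>n. c i * indicator (H i) y)" if y: "y \<in> {0..1}" for y
  proof -
    define i where "i = nat \<lfloor>real n * y\<rfloor>"
    have "real n * y \<le> real n" using y n0 by simp
    then have i: "i \<le> n" unfolding i_def by (simp add: nat_le_iff floor_le_iff)
    have yH: "y \<in> H i" using mem_H[OF y] i_def by simp
    have "(\<Sum>j\<le>n. c j * indicator (H j) y) = (\<Sum>j\<le>n. if j = i then c j else 0)"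
      using mem_H[OF y] by (intro sum.cong) (auto simp: i_def)
    also have "\<dots> = c i" using i by simp
    finally have "(\<Sum>j\<le>n. c j * indicator (H j) y) = c i" .
    moreover have "f y \<le> c i"
    proof (cases "i = n")
      case True
      then have "y = 1" using yH n0 by (auto simp: H_def)
      then show ?thesis using True by (simp add: c_def)
    next
      case False
      then show ?thesis using t[of i y] i yH by (auto simp: c_def H_def)
    qed
    ultimately show ?thesis by simp
  qed
  have H_measure: "measure lborel (H i) = (if i = n then 0 else 1 / real n)" if "i \<le> n" for i
  proof (cases "i = n")
    case True
    then have "H i = {1}" using n0 by (auto simp: H_def)
    then show ?thesis using True by simp
  next
    case False
    then have "real (Suc i) / real n \<le> 1" using that n0 by (simp add: divide_le_eq_1)
    moreover have "0 \<le> real i / real n" by simp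
    ultimately have "H i = {real i / real n..<real (Suc i) / real n}"
      unfolding H_def by (intro Int_absorb2 subsetI) (unfold atLeastAtMost_iff atLeastLessThan_iff, linarith)
    moreover have "real i / real n \<le> real (Suc i) / real n" by (rule divide_right_mono) auto
    ultimately show ?thesis using False by (simp add: diff_divide_distrib[symmetric])
  qed
  have "mean (\<lambda>k. \<Sum>i\<le>n. c i * indicator (H i) (u k)) \<longlonglongrightarrow> (\<Sum>i\<le>n. c i * measure lborel (H i))"
    unfolding mean_sum_scaled
    by (intro tendsto_intros freq) (auto simp: H_def intro!: is_interval_Int is_interval_co is_interval_cc)
  also have "(\<Sum>i\<le>n. c i * measure lborel (H i)) = (\<Sum>i<n. (f (t i) + e / 2) / real n)"
  proof -
    have "{..n} = insert n {..<n}" by auto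
    then show ?thesis by (simp add: H_measure c_def)
  qed
  also have "\<dots> = (\<Sum>i<n. f (t i)) / real n + e / 2"
    using n0 by (simp add: sum_divide_distrib[symmetric] sum.distrib add_divide_distrib)
  finally have "\<forall>\<^sub>F N in sequentially. mean (\<lambda>k. \<Sum>i\<le>n. c i * indicator (H i) (u k)) N < J + e"
    using sum_t by (intro order_tendstoD) auto
  then show ?thesis
  proof eventually_elim
    case (elim N)
    have "mean (\<lambda>k. f (u k)) N \<le> mean (\<lambda>k. \<Sum>i\<le>n. c i * indicator (H i) (u k)) N"
      by (intro mean_mono bound subsetD[OF u]) simp
    with elim show ?case by linarith
  qed
qed

text \<open>The upper estimate is applied to \<open>f\<close> and to its negative; the Riemann value
  coincides with the gauge integral in the conclusion.\<close>

lemma riemann_integrable_mean_tendsto: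
  assumes f: "riemann_integrable f 0 1" and u: "range u \<subseteq> {0..1}"
    and freq: "\<And>I. is_interval I \<Longrightarrow> I \<subseteq> {0..1} \<Longrightarrow> mean (\<lambda>n. indicator I (u n)) \<longlonglongrightarrow> measure lborel I"
  shows "mean (\<lambda>n. f (u n)) \<longlonglongrightarrow> integral {0..1} f"
proof (rule tendstoI)
  obtain J where J: "has_riemann_integral f J 0 1" using f by (auto simp: riemann_integrable_iff)
  then have J_eq: "integral {0..1} f = J"
    using has_riemann_integral_imp_has_integral by blast
  fix e :: real assume e: "e > 0"
  have upper: "\<forall>\<^sub>F N in sequentially. mean (\<lambda>n. g (u n)) N < L + e"
    if "has_riemann_integral g L 0 1" for g L
    using freq by (rule riemann_mean_upper[OF that e u])
  show "\<forall>\<^sub>F N in sequentially. dist (mean (\<lambda>n. f (u n)) N) (integral {0..1} f) < e"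
    using upper[OF J] upper[OF has_riemann_integral_minus[OF J]]
    by eventually_elim (auto simp: mean_minus J_eq dist_real_def)
qed

subsection \<open>Uniformly measurable sequences\<close>

text \<open>Lebesgue measure of the unit interval carried by the whole real line, so that the
  results on Borel probability measures on a metric space type apply to it.\<close>

definition unit_lborel :: "real measure" where
  "unit_lborel = density lborel (indicator {0..1})"

lemma sets_unit_lborel: "sets unit_lborel = sets borel"
  by (simp add: unit_lborel_def)

lemma emeasure_unit_lborel:
  "S \<in> sets borel \<Longrightarrow> emeasure unit_lborel S = emeasure lborel ({0..1} \<inter> S)"
  unfolding unit_lborel_def
  by (simp add: emeasure_density nn_integral_cmult_indicator[symmetric] indicator_inter_arith[symmetric])

lemma measure_unit_lborel:
  "S \<in> sets borel \<Longrightarrow> measure unit_lborel S = measure lborel ({0..1} \<inter> S)"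
  by (simp add: measure_def emeasure_unit_lborel)

lemma prob_space_unit_lborel: "prob_space unit_lborel"
proof
  show "emeasure unit_lborel (space unit_lborel) = 1"
    using emeasure_unit_lborel[of UNIV] by (simp add: unit_lborel_def)
qed

text \<open>Lets convergence of averages to the gauge integral be read as uniform distribution with
  respect to \<open>unit_lborel\<close>.\<close>

lemma integral_unit_lborel:
  fixes f :: "real \<Rightarrow> real"
  assumes "continuous_on UNIV f"
  shows "integral\<^sup>L unit_lborel f = integral {0..1} f"
proof -
  have "f \<in> borel_measurable lborel" using borel_measurable_continuous_onI[OF assms] by simp
  then have "integral\<^sup>L (density lborel (\<lambda>x. ennreal (indicator {0..1} x))) f = (LINT x:{0..1}|lborel. f x)"
    unfolding set_lebesgue_integral_def by (intro integral_density) auto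
  also have "\<dots> = integral {0..1} f"
    by (intro set_borel_integral_eq_integral borel_integrable_atLeastAtMost' continuous_on_subset[OF assms]) simp
  finally show ?thesis by (simp add: unit_lborel_def ennreal_indicator)
qed

text \<open>Intervals are convex, and the frontier of a convex set is Lebesgue null.\<close>

lemma measure_frontier_interval_unit_lborel:
  assumes "is_interval (I :: real set)"
  shows "measure unit_lborel (frontier I) = 0"
proof -
  have "convex I" using assms is_interval_convex by blast
  then have "frontier I \<in> null_sets lebesgue"
    using negligible_convex_frontier negligible_iff_null_sets by blast
  then have "emeasure lborel (frontier I) = 0"
    by (simp add: null_sets_completion_iff null_setsD1)
  then have "emeasure lborel ({0..1} \<inter> frontier I) = 0"
    using emeasure_mono[of "{0..1} \<inter> frontier I" "frontier I" lborel] by simp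
  then show "measure unit_lborel (frontier I) = 0"
    using emeasure_unit_lborel[OF borel_closed[OF frontier_closed]] by (simp add: measure_def)
qed

section \<open>The two directions of the equivalence\<close>

text \<open>Membership in \<open>dens_sets\<close> says that the closures of the preimage and of its
  complement have measures summing to 1, which is what the squeeze between closures
  requires.\<close>

lemma mean_indicator_measurable_sequence:
  fixes P :: "'a::metric_space measure"
  assumes P: "prob_space P" "sets P = sets borel"
    and x: "dens_uniformly_measurable \<iota> P x"
    and k: "uniformly_distributed P (\<lambda>n. \<iota> (k n))"
    and I: "is_interval I" "I \<subseteq> {0..1}"
  shows "mean (\<lambda>n. indicator I (x (k n))) \<longlonglongrightarrow> measure lborel I"
proof -
  have "x -` I \<in> dens_sets \<iota> P" "dens \<iota> P (x -` I) = measure lborel I"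
    using x I by (auto simp: dens_uniformly_measurable_def)
  then have "measure P (closure (\<iota> ` (x -` I))) = measure lborel I"
    "measure P (closure (\<iota> ` (- (x -` I)))) = 1 - measure lborel I"
    by (auto simp: dens_def dens_sets_def upper_dens_def Compl_eq_Diff_UNIV)
  then have "mean (\<lambda>n. indicator (x -` I) (k n)) \<longlonglongrightarrow> measure lborel I"
    by (intro mean_indicator_tendsto_closures[where \<phi> = \<iota>, OF P k]) auto
  then show ?thesis by (simp add: indicator_vimage)
qed

text \<open>Continuous test functions suffice: they make \<open>x (k n)\<close> uniformly
  distributed for Lebesgue measure, which fixes the frequency of every interval. The sequence
  \<open>k\<close> is chosen separately for the preimage of the interval and for its
  complement.\<close>

lemma dens_uniformly_measurableI:
  fixes P :: "'a::metric_space measure"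
  assumes "compact (UNIV :: 'a set)" "prob_space P" "sets P = sets borel" "closure (range \<iota>) = UNIV"
    and x: "range x \<subseteq> {0..1}"
    and lim: "\<And>k f. uniformly_distributed P (\<lambda>n. \<iota> (k n)) \<Longrightarrow> continuous_on {0..1} f \<Longrightarrow>
      mean (\<lambda>n. f (x (k n))) \<longlonglongrightarrow> integral {0..1} f"
  shows "dens_uniformly_measurable \<iota> P x"
  unfolding dens_uniformly_measurable_def
proof (intro allI impI)
  interpret P: prob_space P by fact
  interpret U: prob_space unit_lborel by (rule prob_space_unit_lborel)
  \<comment> \<open>Stated for Borel sets with null frontier rather than intervals, since it is
    applied to the complement of an interval as well.\<close>
  have upper: "measure P (closure (\<iota> ` (x -` S))) \<le> measure unit_lborel S"
    if S: "S \<in> sets borel" "measure unit_lborel (frontier S) = 0" for S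
  proof -
    obtain k where k: "uniformly_distributed P (\<lambda>n. \<iota> (k n))"
      "\<And>p. mean (\<lambda>n. indicator (x -` S) (k n)) \<longlonglongrightarrow> p \<Longrightarrow> measure P (closure (\<iota> ` (x -` S))) \<le> p"
      using exists_uniformly_distributed_closure_frequency[OF assms(1-4)] by blast
    have "uniformly_distributed unit_lborel (\<lambda>n. x (k n))"
      unfolding uniformly_distributed_iff_mean
      using lim[OF k(1)] by (auto simp: integral_unit_lborel intro: continuous_on_subset)
    from mean_indicator_tendsto_continuity_set[OF prob_space_unit_lborel sets_unit_lborel this S]
    show ?thesis by (intro k(2)) (simp add: indicator_vimage)
  qed
  fix I :: "real set" assume I: "is_interval I \<and> I \<subseteq> {0..1}"
  note S = real_interval_borel_measurable[OF conjunct1[OF I]]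
    measure_frontier_interval_unit_lborel[OF conjunct1[OF I]]
  have U_I: "measure unit_lborel I = measure lborel I"
    using I by (simp add: measure_unit_lborel[OF S(1)] Int_absorb1)
  have U_compl: "measure unit_lborel (- I) = 1 - measure lborel I"
    using U.prob_compl[of I] S(1) sets_eq_imp_space_eq[OF sets_unit_lborel]
    by (simp add: Compl_eq_Diff_UNIV U_I sets_unit_lborel)
  let ?A = "closure (\<iota> ` (x -` I))" and ?B = "closure (\<iota> ` (- (x -` I)))"
  have A: "measure P ?A \<le> measure lborel I" using upper[OF S] U_I by simp
  have B: "measure P ?B \<le> 1 - measure lborel I"
    using upper[of "- I"] S U_compl by (simp add: frontier_complement vimage_Compl)
  \<comment> \<open>The union of the two closures is the closure of the dense range, so their
    measures sum to at least 1 and both upper bounds must be equalities.\<close>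
  have "?A \<union> ?B = closure (\<iota> ` (x -` I \<union> - (x -` I)))"
    by (simp only: closure_Un[symmetric] image_Un)
  then have "?A \<union> ?B = space P"
    using assms(4) sets_eq_imp_space_eq[OF assms(3)] by simp
  then have "1 \<le> measure P ?A + measure P ?B"
    using measure_Un_le[of ?A P ?B] assms(3) P.prob_space by simp
  with A B have "measure P ?A = measure lborel I" "measure P ?A + measure P ?B = 1" by linarith+
  then show "x -` I \<in> dens_sets \<iota> P \<and> dens \<iota> P (x -` I) = measure lborel I"
    by (simp add: dens_def dens_sets_def upper_dens_def Compl_eq_Diff_UNIV)
qed

theorem theorem3:
  fixes \<iota> :: "nat \<Rightarrow> 'a::metric_space"
    and P :: "'a measure"
    and x :: "nat \<Rightarrow> real"
  assumes "compact (UNIV :: 'a set)"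
    and "prob_space P"
    and "sets P = sets borel"
    and "inj \<iota>"
    and "closure (range \<iota>) = UNIV"
    and "range x \<subseteq> {0..1}"
  shows "(dens_uniformly_measurable \<iota> P x \<longleftrightarrow>
           (\<forall>k :: nat \<Rightarrow> nat. uniformly_distributed P (\<lambda>n. \<iota> (k n)) \<longrightarrow>
             (\<forall>f :: real \<Rightarrow> real. riemann_integrable f 0 1 \<longrightarrow>
               (\<lambda>N. (1 / real N) * (\<Sum>n=1..N. f (x (k n)))) \<longlonglongrightarrow> integral {0..1} f)))
       \<and> (dens_uniformly_measurable \<iota> P x \<longleftrightarrow>
           (\<forall>k :: nat \<Rightarrow> nat. uniformly_distributed P (\<lambda>n. \<iota> (k n)) \<longrightarrow>
             (\<forall>f :: real \<Rightarrow> real. continuous_on {0..1} f \<longrightarrow>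
               (\<lambda>N. (1 / real N) * (\<Sum>n=1..N. f (x (k n)))) \<longlonglongrightarrow> integral {0..1} f)))"
proof -
  let ?limit = "\<lambda>k f. mean (\<lambda>n. f (x (k n))) \<longlonglongrightarrow> integral {0..1} f"
  let ?riemann = "\<forall>k. uniformly_distributed P (\<lambda>n. \<iota> (k n)) \<longrightarrow> (\<forall>f. riemann_integrable f 0 1 \<longrightarrow> ?limit k f)"
  let ?continuous = "\<forall>k. uniformly_distributed P (\<lambda>n. \<iota> (k n)) \<longrightarrow> (\<forall>f. continuous_on {0..1} f \<longrightarrow> ?limit k f)"
  \<comment> \<open>Three implications in a cycle give both equivalences.\<close>
  have "?riemann" if x: "dens_uniformly_measurable \<iota> P x"
  proof (intro allI impI)
    fix k :: "nat \<Rightarrow> nat" and f :: "real \<Rightarrow> real"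
    assume k: "uniformly_distributed P (\<lambda>n. \<iota> (k n))" and f: "riemann_integrable f 0 1"
    show "?limit k f"
    proof (rule riemann_integrable_mean_tendsto[OF f])
      show "range (\<lambda>n. x (k n)) \<subseteq> {0..1}" using assms(6) by auto
    qed (rule mean_indicator_measurable_sequence[OF assms(2,3) x k])
  qed
  moreover have "?riemann \<Longrightarrow> ?continuous"
    using continuous_imp_riemann_integrable by blast
  moreover have "dens_uniformly_measurable \<iota> P x" if "?continuous"
    using that by (intro dens_uniformly_measurableI[OF assms(1-3,5,6)]) blast
  ultimately have "(dens_uniformly_measurable \<iota> P x \<longleftrightarrow> ?riemann) \<and> (dens_uniformly_measurable \<iota> P x \<longleftrightarrow> ?continuous)"
    by blast
  then show ?thesis unfolding mean_def[abs_def] .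
qed

end
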